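(* Let $\mathcal{B}$ be a dense $*$-subalgebra of a C$^*$-algebra $\mathcal{A}$ satisfying the following two hypotheses: (1) for all $b\in\mathcal{B}$, the equality $r_{\mathcal{B}}(b^*b)=r_{\mathcal{A}}(b^*b)$ of spectral radii holds; (2) for every closed ideal $\mathcal{I}$ of $\mathcal{A}$, $\mathcal{I}\cap\mathcal{B}$ is a dense $*$-subalgebra of $\mathcal{I}$. Then the only C$^*$-norm which may possibly be defined on $\mathcal{B}$ is the restriction of $\|\cdot\|_{\mathcal{A}}$ to $\mathcal{B}$.
   Context: $\|\cdot\|_{\mathcal{A}}$ is the C$^*$-norm of $\mathcal{A}$. A C$^*$-norm on a $*$-algebra $\mathcal{B}$ (not assumed complete) is a vector space norm $p$ with $p(ab)\leqslant p(a)p(b)$, $p(b^* )=p(b)$ and $p(b^*b)=p(b)^2$ for all $a,b\in\mathcal{B}$. For an algebra $\mathcal{D}$ and $a\in\mathcal{D}$: if $\mathcal{D}$ is unital, the spectrum $\sigma_{\mathcal{D}}(a)\subseteq\mathbb{C}$ is the set of $\lambda$ such that $\lambda 1_{\mathcal{D}}-a$ is not invertible in $\mathcal{D}$; if $\mathcal{D}$ is non-unital, $\sigma_{\mathcal{D}}(a)$ is the spectrum of $(a,0)$ in the unitization $\tilde{\mathcal{D}}$. If $\sigma_{\mathcal{D}}(a)\neq\emptyset$, the spectral radius is $r_{\mathcal{D}}(a):=\sup\{|\lambda|:\lambda\in\sigma_{\mathcal{D}}(a)\}$. "Ideal" means two-sided ideal. *)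

theory Defs
  imports "HOL-Analysis.Analysis"
begin

text \<open>A not necessarily unital C*-algebra. Real scalar multiplication, the norm and completeness come
  from \<open>real_normed_algebra\<close> and \<open>banach\<close>; the complex scalar multiplication extends the real one.\<close>

class cstar_algebra = banach + real_normed_algebra +
  fixes scaleC :: "complex \<Rightarrow> 'a \<Rightarrow> 'a" (infixr "*\<^sub>C" 75)
    and star :: "'a \<Rightarrow> 'a"
  assumes scaleC_add_right: "c *\<^sub>C (x + y) = c *\<^sub>C x + c *\<^sub>C y"
    and scaleC_add_left: "(c + d) *\<^sub>C x = c *\<^sub>C x + d *\<^sub>C x"
    and scaleC_scaleC: "c *\<^sub>C (d *\<^sub>C x) = (c * d) *\<^sub>C x"
    and scaleC_one: "1 *\<^sub>C x = x"
    and scaleC_of_real: "complex_of_real r *\<^sub>C x = r *\<^sub>R x"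
    and mult_scaleC_left: "(c *\<^sub>C x) * y = c *\<^sub>C (x * y)"
    and mult_scaleC_right: "x * (c *\<^sub>C y) = c *\<^sub>C (x * y)"
    and norm_scaleC: "norm (c *\<^sub>C x) = cmod c * norm x"
    and star_star: "star (star x) = x"
    and star_add: "star (x + y) = star x + star y"
    and star_scaleC: "star (c *\<^sub>C x) = cnj c *\<^sub>C star x"
    and star_mult: "star (x * y) = star y * star x"
    and norm_star_mult_self: "norm (star x * x) = (norm x)\<^sup>2"

definition complex_subspace :: "'a::cstar_algebra set \<Rightarrow> bool" where
  "complex_subspace S \<longleftrightarrow>
     0 \<in> S \<and> (\<forall>x\<in>S. \<forall>y\<in>S. x + y \<in> S) \<and> (\<forall>c. \<forall>x\<in>S. c *\<^sub>C x \<in> S)"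

definition star_subalgebra :: "'a::cstar_algebra set \<Rightarrow> bool" where
  "star_subalgebra B \<longleftrightarrow>
     complex_subspace B \<and> (\<forall>x\<in>B. \<forall>y\<in>B. x * y \<in> B) \<and> (\<forall>x\<in>B. star x \<in> B)"

definition two_sided_ideal :: "'a::cstar_algebra set \<Rightarrow> bool" where
  "two_sided_ideal I \<longleftrightarrow>
     complex_subspace I \<and> (\<forall>x\<in>I. \<forall>a. a * x \<in> I \<and> x * a \<in> I)"

text \<open>Below, a set \<open>D\<close> is a subalgebra of the ambient C*-algebra, regarded as an algebra in its own
  right; the ambient algebra itself is \<open>UNIV\<close>. A unit of \<open>D\<close> has to lie in \<open>D\<close>, and the inverses that
  determine the spectrum relative to \<open>D\<close> have to lie in \<open>D\<close> or in its unitization.\<close>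

definition is_one_of :: "'a::cstar_algebra set \<Rightarrow> 'a \<Rightarrow> bool" where
  "is_one_of D e \<longleftrightarrow> e \<in> D \<and> (\<forall>x\<in>D. e * x = x \<and> x * e = x)"

definition unital :: "'a::cstar_algebra set \<Rightarrow> bool" where
  "unital D \<longleftrightarrow> (\<exists>e. is_one_of D e)"

definition one_of :: "'a::cstar_algebra set \<Rightarrow> 'a" where
  "one_of D = (THE e. is_one_of D e)"

definition invertible_in :: "('b \<Rightarrow> 'b \<Rightarrow> 'b) \<Rightarrow> 'b set \<Rightarrow> 'b \<Rightarrow> 'b \<Rightarrow> bool" where
  "invertible_in m D e x \<longleftrightarrow> x \<in> D \<and> (\<exists>y\<in>D. m x y = e \<and> m y x = e)"

text \<open>The unitization of \<open>D\<close> is \<open>D \<times> \<complex>\<close> with the product below and unit \<open>(0, 1)\<close>; the pair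
  \<open>(a, z)\<close> stands for \<open>a + z 1\<close>.\<close>

definition unitization_mult ::
    "'a::cstar_algebra \<times> complex \<Rightarrow> 'a \<times> complex \<Rightarrow> 'a \<times> complex" where
  "unitization_mult u v =
     (fst u * fst v + snd u *\<^sub>C fst v + snd v *\<^sub>C fst u, snd u * snd v)"

definition spectrum :: "'a::cstar_algebra set \<Rightarrow> 'a \<Rightarrow> complex set" where
  "spectrum D a =
     (if unital D
      then {z. \<not> invertible_in (*) D (one_of D) (z *\<^sub>C one_of D - a)}
      else {z. \<not> invertible_in unitization_mult (D \<times> UNIV) (0, 1) ((0, z) - (a, 0))})"

text \<open>The supremum is taken in the extended reals because the spectrum relative to an algebra that is
  not complete can be unbounded. The spectra below are empty only in the zero algebra, where the
  value is \<open>-\<infinity>\<close>.\<close>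

definition spectral_radius :: "'a::cstar_algebra set \<Rightarrow> 'a \<Rightarrow> ereal" where
  "spectral_radius D a = (SUP z\<in>spectrum D a. ereal (cmod z))"

text \<open>Only the values of \<open>p\<close> on \<open>B\<close> matter.\<close>

definition cstar_norm_on :: "'a::cstar_algebra set \<Rightarrow> ('a \<Rightarrow> real) \<Rightarrow> bool" where
  "cstar_norm_on B p \<longleftrightarrow>
     (\<forall>a\<in>B. 0 \<le> p a) \<and>
     (\<forall>a\<in>B. p a = 0 \<longleftrightarrow> a = 0) \<and>
     (\<forall>a\<in>B. \<forall>b\<in>B. p (a + b) \<le> p a + p b) \<and>
     (\<forall>c. \<forall>a\<in>B. p (c *\<^sub>C a) = cmod c * p a) \<and>
     (\<forall>a\<in>B. \<forall>b\<in>B. p (a * b) \<le> p a * p b) \<and>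
     (\<forall>b\<in>B. p (star b) = p b) \<and>
     (\<forall>b\<in>B. p (star b * b) = (p b)\<^sup>2)"

end

theory Submission
  imports Defs "HOL-Computational_Algebra.Fundamental_Theorem_Algebra"
begin

text \<open>Let \<open>p\<close> be a C*-norm on \<open>B\<close>. Then \<open>p (b\<^sup>* b)\<close> is bounded by the spectral radius of
  \<open>b\<^sup>* b\<close> in \<open>B\<close>, which by (1) is at most \<open>norm (b\<^sup>* b)\<close>; so \<open>p\<close> is dominated by the norm and
  extends continuously to a seminorm \<open>P\<close> on the whole algebra. The kernel of \<open>P\<close> is a closed ideal
  that meets \<open>B\<close> only in \<open>0\<close>, hence is \<open>0\<close> by (2). Finally, the C*-norm is minimal among the
  submultiplicative norms below it on self-adjoint elements: if \<open>h\<close> is self-adjoint of norm \<open>1\<close>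
  and, after a change of sign, \<open>1\<close> is in its spectrum, functions \<open>f \<noteq> 0\<close> and \<open>g\<close> of \<open>h\<close> supported near \<open>1\<close> with
  \<open>g f = f\<close> satisfy \<open>P (f - h f) = P ((g - h g) f) \<le> norm (g - h g) P f\<close>, which forces \<open>P h \<ge> 1\<close>.\<close>

subsection \<open>C*-algebras\<close>

interpretation scaleC: module "scaleC :: complex \<Rightarrow> 'a::cstar_algebra \<Rightarrow> 'a"
  by unfold_locales
    (simp_all add: scaleC_add_right scaleC_add_left scaleC_scaleC scaleC_one)

lemmas scaleC_simps = scaleC_add_right scaleC_add_left scaleC_scaleC scaleC_one
  mult_scaleC_left mult_scaleC_right

lemma star_zero: "star (0::'a::cstar_algebra) = 0"
  using star_scaleC[of 0 "0::'a"] by simp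

lemma star_minus: "star (- x) = - star (x::'a::cstar_algebra)"
  using star_scaleC[of "-1" x] by (simp add: scaleC_one)

text \<open>The C*-identity and submultiplicativity give norm y ^ 2 \<le> norm (star y) * norm y;
  cancel, and apply this to \<open>star y\<close> too.\<close>

lemma norm_star: "norm (star x) = norm (x::'a::cstar_algebra)"
proof -
  have le: "norm y \<le> norm (star y)" for y :: 'a
  proof (cases "y = 0")
    case False
    have "norm y * norm y \<le> norm (star y) * norm y"
      using norm_mult_ineq[of "star y" y] by (simp add: norm_star_mult_self power2_eq_square)
    with False show ?thesis by simp
  qed simp
  show ?thesis using le[of x] le[of "star x"] by (simp add: star_star)
qed

lemma star_subalgebraD:
  assumes "star_subalgebra B"
  shows "0 \<in> B" "x \<in> B \<Longrightarrow> y \<in> B \<Longrightarrow> x + y \<in> B" "x \<in> B \<Longrightarrow> c *\<^sub>C x \<in> B"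
    "x \<in> B \<Longrightarrow> y \<in> B \<Longrightarrow> x * y \<in> B" "x \<in> B \<Longrightarrow> star x \<in> B"
    "x \<in> B \<Longrightarrow> - x \<in> B" "x \<in> B \<Longrightarrow> y \<in> B \<Longrightarrow> x - y \<in> B"
proof -
  show *: "0 \<in> B" "x \<in> B \<Longrightarrow> y \<in> B \<Longrightarrow> x + y \<in> B" "x \<in> B \<Longrightarrow> c *\<^sub>C x \<in> B"
    "x \<in> B \<Longrightarrow> y \<in> B \<Longrightarrow> x * y \<in> B" "x \<in> B \<Longrightarrow> star x \<in> B" for x y c
    using assms unfolding star_subalgebra_def complex_subspace_def by auto
  show m: "x \<in> B \<Longrightarrow> - x \<in> B" for x
    using *(3)[of x "-1"] by (simp add: scaleC_one)
  show "x \<in> B \<Longrightarrow> y \<in> B \<Longrightarrow> x - y \<in> B"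
    using *(2)[of x "-y"] m[of y] by simp
qed

lemma star_subalgebra_UNIV: "star_subalgebra UNIV"
  by (simp add: star_subalgebra_def complex_subspace_def)

lemma cstar_norm_on_norm:
  assumes "star_subalgebra B" and "\<And>b. b \<in> B \<Longrightarrow> p b = norm b"
  shows "cstar_norm_on B p"
  unfolding cstar_norm_on_def
  by (auto simp: assms star_subalgebraD[OF assms(1)] norm_triangle_ineq norm_scaleC
      norm_mult_ineq norm_star norm_star_mult_self)

subsection \<open>Quasi-inverses and the spectrum\<close>

text \<open>Formally \<open>(1 - x) (1 - y) = 1 - circ x y\<close>, so that \<open>y\<close> is a quasi-inverse of \<open>x\<close> iff
  \<open>1 - y\<close> is an inverse of \<open>1 - x\<close>; this avoids distinguishing unital and non-unital algebras.\<close>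

definition circ :: "'a::ring \<Rightarrow> 'a \<Rightarrow> 'a" where
  "circ x y = x + y - x * y"

definition quasi_inverse :: "'a::ring \<Rightarrow> 'a \<Rightarrow> bool" where
  "quasi_inverse x y \<longleftrightarrow> circ x y = 0 \<and> circ y x = 0"

definition quasi_invertible :: "'a::ring set \<Rightarrow> 'a \<Rightarrow> bool" where
  "quasi_invertible D x \<longleftrightarrow> (\<exists>y\<in>D. quasi_inverse x y)"

lemma circ_assoc: "circ (circ x y) z = circ x (circ y z)"
  by (simp add: circ_def algebra_simps)

lemma circ_0 [simp]: "circ 0 x = x" "circ x 0 = x"
  by (simp_all add: circ_def)

lemma quasi_inverse_zero: "quasi_inverse 0 0"
  by (simp add: quasi_inverse_def)

lemma quasi_inverseD:
  assumes "quasi_inverse x y"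
  shows "x * y = x + y" "y * x = x + y"
proof -
  have "x + y - x * y = 0" "y + x - y * x = 0"
    using assms by (simp_all add: quasi_inverse_def circ_def)
  then show "x * y = x + y" "y * x = x + y" by (simp_all add: add.commute)
qed

lemma quasi_inverse_circ:
  assumes "quasi_inverse x x'" "quasi_inverse y y'"
  shows "quasi_inverse (circ x y) (circ y' x')"
  using assms unfolding quasi_inverse_def by (metis circ_assoc circ_0)

lemma quasi_invertible_circ:
  "quasi_invertible UNIV x \<Longrightarrow> quasi_invertible UNIV y \<Longrightarrow> quasi_invertible UNIV (circ x y)"
  unfolding quasi_invertible_def using quasi_inverse_circ by blast

text \<open>In the monoid of \<open>circ\<close> with unit 0, an inverse of a product of commuting
  factors yields a right and a left inverse of the factor, and these coincide.\<close>

lemma quasi_invertible_circ_left: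
  assumes "quasi_invertible UNIV (circ x y)" "circ x y = circ y x"
  shows "quasi_invertible UNIV x"
proof -
  obtain w where w: "circ (circ x y) w = 0" "circ w (circ x y) = 0"
    using assms(1) by (auto simp: quasi_invertible_def quasi_inverse_def)
  have r: "circ x (circ y w) = 0" and l: "circ (circ w y) x = 0"
    using w assms(2) by (metis circ_assoc)+
  have "circ w y = circ y w"
    using r l by (metis circ_assoc circ_0)
  with r l show ?thesis by (auto simp: quasi_invertible_def quasi_inverse_def)
qed

text \<open>With \<open>R x = 1 / (1 - x)\<close> this is \<open>R (y\<^sup>2) = (R y + R (- y)) / 2\<close>.\<close>

lemma quasi_inverse_square:
  fixes y :: "'a::cstar_algebra"
  assumes "quasi_inverse y a" "quasi_inverse (- y) b"
  shows "quasi_inverse (y * y) ((1/2) *\<^sub>C (a + b))"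
proof -
  note a = quasi_inverseD[OF assms(1)]
  have b: "y * b = y - b" "b * y = y - b"
    using quasi_inverseD[OF assms(2)] by (simp_all add: algebra_simps minus_equation_iff)
  have half: "x = (1/2) *\<^sub>C (x + x)" for x :: 'a
    by (simp flip: scaleC.scale_left_distrib add: scaleC_one scaleC_add_right)
  have "y * y * (a + b) = (y * y + y * y) + (a + b)"
    by (simp add: algebra_simps a b mult.assoc)
  moreover have "(a + b) * (y * y) = (y * y + y * y) + (a + b)"
  proof -
    have "(a + b) * (y * y) = (a * y) * y + (b * y) * y" by (simp add: algebra_simps)
    then show ?thesis by (simp add: algebra_simps a b)
  qed
  ultimately show ?thesis
    unfolding quasi_inverse_def circ_def
    by (simp add: mult_scaleC_left mult_scaleC_right scaleC_add_right[of _ "y*y + y*y"] flip: half)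
qed

text \<open>The resolvent identity \<open>R x - R y = R x (x - y) R y\<close>.\<close>

lemma quasi_inverse_resolvent:
  fixes x y :: "'a::ring"
  assumes "quasi_inverse x a" "quasi_inverse y b"
  shows "b - a = (x - y) - a * (x - y) - (x - y) * b + a * (x - y) * b"
proof -
  have "a * x * b = (x + a) * b" "a * y * b = a * (y + b)"
    using quasi_inverseD[OF assms(1)] quasi_inverseD[OF assms(2)] by (simp_all add: mult.assoc)
  then show ?thesis
    using quasi_inverseD[OF assms(1)] quasi_inverseD[OF assms(2)] by (simp add: algebra_simps)
qed

text \<open>For nonzero z, z 1 - a = z (1 - a / z), and an inverse of 1 - a / z has the form 1 - q.
  Both cases of \<open>spectrum\<close> thus reduce to quasi-inverses inside
  \<open>D\<close>.\<close>

lemma spectrum_iff_quasi_invertible: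
  fixes a :: "'a::cstar_algebra"
  assumes D: "star_subalgebra D" and a: "a \<in> D" and z: "z \<noteq> 0"
  shows "z \<in> spectrum D a \<longleftrightarrow> \<not> quasi_invertible D (inverse z *\<^sub>C a)"
proof (cases "unital D")
  case True
  then obtain e where e: "is_one_of D e" unfolding unital_def by blast
  have "one_of D = e"
    unfolding one_of_def using e by (intro the_equality) (rule e, metis is_one_of_def)
  note D' = star_subalgebraD[OF D]
  have eD: "e \<in> D" and e1: "\<And>x. x \<in> D \<Longrightarrow> e * x = x" "\<And>x. x \<in> D \<Longrightarrow> x * e = x"
    using e by (auto simp: is_one_of_def)
  have "invertible_in (*) D e (z *\<^sub>C e - a) \<longleftrightarrow> quasi_invertible D (inverse z *\<^sub>C a)"
  proof
    assume "invertible_in (*) D e (z *\<^sub>C e - a)"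
    then obtain y where y: "y \<in> D" "(z *\<^sub>C e - a) * y = e" "y * (z *\<^sub>C e - a) = e"
      by (auto simp: invertible_in_def)
    have "a * y = z *\<^sub>C y - e" "y * a = z *\<^sub>C y - e"
      using y e1[OF y(1)] by (simp_all add: algebra_simps scaleC_simps)
    then have "quasi_inverse (inverse z *\<^sub>C a) (e - z *\<^sub>C y)"
      using z by (simp add: quasi_inverse_def circ_def algebra_simps scaleC_simps e1 a
          scaleC.scale_right_diff_distrib)
    then show "quasi_invertible D (inverse z *\<^sub>C a)"
      using y eD by (auto simp: quasi_invertible_def D')
  next
    assume "quasi_invertible D (inverse z *\<^sub>C a)"
    then obtain q where q: "q \<in> D" "quasi_inverse (inverse z *\<^sub>C a) q"
      by (auto simp: quasi_invertible_def)
    have "inverse z *\<^sub>C (a * q) = inverse z *\<^sub>C a + q" "inverse z *\<^sub>C (q * a) = inverse z *\<^sub>C a + q"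
      using quasi_inverseD[OF q(2)] by (simp_all add: scaleC_simps)
    then have "(z *\<^sub>C e - a) * (inverse z *\<^sub>C (e - q)) = e"
        "(inverse z *\<^sub>C (e - q)) * (z *\<^sub>C e - a) = e"
      using z q(1) by (simp_all add: algebra_simps scaleC_simps e1 eD a
          scaleC.scale_right_diff_distrib)
    then show "invertible_in (*) D e (z *\<^sub>C e - a)"
      unfolding invertible_in_def using q(1) eD a
      by (intro conjI bexI[of _ "inverse z *\<^sub>C (e - q)"]) (simp_all add: D')
  qed
  then show ?thesis using True \<open>one_of D = e\<close> by (simp add: spectrum_def)
next
  case False
  note D' = star_subalgebraD[OF D]
  let ?u = "(0, z) - (a, 0)"
  have "invertible_in unitization_mult (D \<times> UNIV) (0, 1) ?u
    \<longleftrightarrow> quasi_invertible D (inverse z *\<^sub>C a)"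
  proof
    assume "invertible_in unitization_mult (D \<times> UNIV) (0, 1) ?u"
    then obtain y w where y: "y \<in> D" "unitization_mult ?u (y, w) = (0, 1)"
      "unitization_mult (y, w) ?u = (0, 1)"
      by (auto simp: invertible_in_def)
    \<comment> \<open>The scalar component forces w = 1 / z, so the candidate 1 - z (y + w 1) = - z
      y lies in \<open>D\<close>.\<close>
    then have w: "w = inverse z" and "a * y = z *\<^sub>C y - w *\<^sub>C a" "y * a = z *\<^sub>C y - w *\<^sub>C a"
      using z by (auto simp: unitization_mult_def field_simps inverse_unique)
    then have "quasi_inverse (inverse z *\<^sub>C a) (- (z *\<^sub>C y))"
      using z by (simp add: quasi_inverse_def circ_def algebra_simps scaleC_simps
          scaleC.scale_right_diff_distrib)
    then show "quasi_invertible D (inverse z *\<^sub>C a)"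
      using y by (auto simp: quasi_invertible_def D')
  next
    assume "quasi_invertible D (inverse z *\<^sub>C a)"
    then obtain q where q: "q \<in> D" "quasi_inverse (inverse z *\<^sub>C a) q"
      by (auto simp: quasi_invertible_def)
    have "inverse z *\<^sub>C (a * q) = inverse z *\<^sub>C a + q" "inverse z *\<^sub>C (q * a) = inverse z *\<^sub>C a + q"
      using quasi_inverseD[OF q(2)] by (simp_all add: scaleC_simps)
    then have "unitization_mult ?u (- (inverse z *\<^sub>C q), inverse z) = (0, 1)"
      "unitization_mult (- (inverse z *\<^sub>C q), inverse z) ?u = (0, 1)"
      using z by (simp_all add: unitization_mult_def scaleC_simps algebra_simps)
    then show "invertible_in unitization_mult (D \<times> UNIV) (0, 1) ?u"
      unfolding invertible_in_def using q(1) a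
      by (intro conjI bexI[of _ "(- (inverse z *\<^sub>C q), inverse z)"]) (simp_all add: D')
  qed
  then show ?thesis using False by (simp add: spectrum_def)
qed

text \<open>Banach's fixed point theorem replaces the Neumann series: x q = x + q is the fixed point
  equation of the contraction u -> x u - x.\<close>

lemma quasi_invertible_norm_less_1:
  fixes x :: "'a::{banach, real_normed_algebra}"
  assumes "norm x < 1"
  shows "quasi_invertible UNIV x"
proof -
  have "\<exists>!q. x * q - x = q"
  proof (rule banach_fix_type)
    show "\<forall>u. \<forall>v. dist (x * u - x) (x * v - x) \<le> norm x * dist u v"
      by (auto simp: dist_norm norm_mult_ineq simp flip: right_diff_distrib)
  qed (use assms in auto)
  then obtain q where q: "x * q = x + q" by (auto simp: algebra_simps)
  \<comment> \<open>So far \<open>q\<close> is only a right quasi-inverse; \<open>d\<close> measures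
    the failure to commute, and d = x d forces it to vanish.\<close>
  define d where "d = q * x - x * q"
  have "d = x * d"
  proof -
    have "q * x = x * (q * x) - x * x" "x * q = x * (x * q) - x * x"
      using q by (simp_all add: distrib_left flip: mult.assoc) (simp add: distrib_right)
    from arg_cong2[OF this, of "(-)"] have "q * x - x * q = x * (q * x) - x * (x * q)" by simp
    then show ?thesis unfolding d_def right_diff_distrib .
  qed
  then have "norm d \<le> norm x * norm d" by (metis norm_mult_ineq)
  with assms have "d = 0"
    by (metis mult_le_cancel_right1 norm_le_zero_iff not_less)
  with q have "quasi_inverse x q"
    by (simp add: quasi_inverse_def circ_def d_def add.commute)
  then show ?thesis by (auto simp: quasi_invertible_def)
qed

subsection \<open>The spectral radius of self-adjoint elements\<close>

locale normed_star_subalgebra =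
  fixes B :: "'a::cstar_algebra set" and p :: "'a \<Rightarrow> real"
  assumes subalgebra: "star_subalgebra B" and cstar_norm: "cstar_norm_on B p"
begin

lemmas closed_simps [simp] = star_subalgebraD[OF subalgebra]

lemma
  shows p_nonneg [simp]: "a \<in> B \<Longrightarrow> 0 \<le> p a"
    and p_eq_0_iff: "a \<in> B \<Longrightarrow> p a = 0 \<longleftrightarrow> a = 0"
    and p_triangle: "a \<in> B \<Longrightarrow> b \<in> B \<Longrightarrow> p (a + b) \<le> p a + p b"
    and p_scaleC: "a \<in> B \<Longrightarrow> p (c *\<^sub>C a) = cmod c * p a"
    and p_mult: "a \<in> B \<Longrightarrow> b \<in> B \<Longrightarrow> p (a * b) \<le> p a * p b"
    and p_star_mult: "a \<in> B \<Longrightarrow> p (star a * a) = (p a)\<^sup>2"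
  using cstar_norm by (simp_all add: cstar_norm_on_def)

lemma p_minus: "a \<in> B \<Longrightarrow> p (- a) = p a"
  using p_scaleC[of a "-1"] by (simp add: scaleC_one)

lemma p_triangle_diff: "a \<in> B \<Longrightarrow> b \<in> B \<Longrightarrow> p (a - b) \<le> p a + p b"
  using p_triangle[of a "- b"] by (simp add: p_minus)

text \<open>Formally 1 + p a bounds the resolvent 1 - a. The product (1 - a) (x - y) (1 - b) is
  expanded into four terms because \<open>B\<close> may lack a unit.\<close>

lemma p_resolvent_le:
  assumes "x \<in> B" "y \<in> B" "a \<in> B" "b \<in> B" "quasi_inverse x a" "quasi_inverse y b"
  shows "p (b - a) \<le> p (x - y) * (1 + p a) * (1 + p b)"
proof -
  define d where "d = x - y"
  have d: "d \<in> B" using assms by (simp add: d_def)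
  have "p (b - a) = p (((d - a * d) - d * b) + (a * d) * b)"
    using quasi_inverse_resolvent[OF assms(5,6)] by (simp add: d_def)
  also have "\<dots> \<le> p ((d - a * d) - d * b) + p ((a * d) * b)"
    using assms d by (intro p_triangle) auto
  also have "\<dots> \<le> (p d + p (a * d)) + p (d * b) + p ((a * d) * b)"
    using assms d p_triangle_diff[of "d - a * d" "d * b"] p_triangle_diff[of d "a * d"] by auto
  also have "\<dots> \<le> (p d + p a * p d) + p d * p b + (p a * p d) * p b"
  proof -
    have "p ((a * d) * b) \<le> p (a * d) * p b" using assms d by (intro p_mult) auto
    also have "\<dots> \<le> (p a * p d) * p b" using assms d by (intro mult_right_mono p_mult) auto
    finally show ?thesis using p_mult[of a d] p_mult[of d b] assms d by auto
  qed
  finally show ?thesis by (simp add: d_def algebra_simps)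
qed

lemma p_quasi_inverse_le:
  assumes "x \<in> B" "a \<in> B" "quasi_inverse x a" "p x \<le> 1/2"
  shows "p a \<le> 2 * p x"
proof -
  have "a = x * a - x" using quasi_inverseD[OF assms(3)] by simp
  then have "p a \<le> p (x * a) + p x" using p_triangle_diff[of "x * a" x] assms by auto
  also have "p (x * a) \<le> p x * p a" using assms by (intro p_mult)
  also have "\<dots> \<le> 1/2 * p a" using assms by (intro mult_right_mono) auto
  finally show ?thesis by simp
qed

text \<open>On self-adjoint elements the C*-identity reads p (x x) = (p x) ^ 2, and squares stay
  self-adjoint.\<close>

lemma funpow_square:
  fixes k defines "S \<equiv> (\<lambda>x. x * x) ^^ k"
  assumes "h \<in> B" "star h = h"
  shows "S h \<in> B" "star (S h) = S h" "p (S h) = p h ^ (2 ^ k)"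
proof -
  have "S h \<in> B \<and> star (S h) = S h \<and> p (S h) = p h ^ (2 ^ k)"
    unfolding S_def
  proof (induction k)
    case (Suc k)
    then show ?case using p_star_mult[of "((\<lambda>x. x * x) ^^ k) h"]
      by (simp add: star_mult power_even_eq)
  qed (use assms in auto)
  then show "S h \<in> B" "star (S h) = S h" "p (S h) = p h ^ (2 ^ k)" by auto
qed

lemma square_scaleC: "(c *\<^sub>C x) * (c *\<^sub>C x) = c\<^sup>2 *\<^sub>C (x * (x :: 'a))"
  by (simp add: scaleC_simps power2_eq_square)

text \<open>The resolvent of \<open>h\<close> is uniformly continuous on compact sets; averaging over square roots
  carries the bound over to all powers \<open>h ^ (2 ^ k)\<close>. This replaces roots of unity of order
  \<open>2 ^ k\<close> in Rickart's elementary proof of the spectral radius formula, and needs no completeness.\<close>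

lemma quasi_inverse_funpow_close:
  fixes k defines "S \<equiv> (\<lambda>x. x * x) ^^ k"
  assumes h: "h \<in> B" "h' \<in> B"
    and base: "\<And>w. cmod w = 1 \<Longrightarrow> \<exists>a\<in>B. \<exists>b\<in>B. quasi_inverse (w *\<^sub>C h) a \<and>
                 quasi_inverse (w *\<^sub>C h') b \<and> p (a - b) \<le> e"
    and w: "cmod w = 1"
  shows "\<exists>a\<in>B. \<exists>b\<in>B. quasi_inverse (w *\<^sub>C S h) a \<and> quasi_inverse (w *\<^sub>C S h') b \<and> p (a - b) \<le> e"
  using w unfolding S_def
proof (induction k arbitrary: w)
  case 0
  then show ?case using base by simp
next
  case (Suc k)
  let ?h = "((\<lambda>x. x * x) ^^ k) h" and ?h' = "((\<lambda>x. x * x) ^^ k) h'"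
  \<comment> \<open>Both square roots of w lie on the unit circle, so the induction hypothesis
    applies to each; averaging the two results gives the new quasi-inverses.\<close>
  let ?v = "csqrt w"
  have v: "cmod ?v = 1" "cmod (- ?v) = 1" using Suc.prems by simp_all
  obtain a b where ab: "a \<in> B" "b \<in> B" "quasi_inverse (?v *\<^sub>C ?h) a"
      "quasi_inverse (?v *\<^sub>C ?h') b" "p (a - b) \<le> e"
    using Suc.IH[OF v(1)] by blast
  obtain c d where cd: "c \<in> B" "d \<in> B" "quasi_inverse (- (?v *\<^sub>C ?h)) c"
      "quasi_inverse (- (?v *\<^sub>C ?h')) d" "p (c - d) \<le> e"
    using Suc.IH[OF v(2)] unfolding scaleC.scale_minus_left by blast
  have "quasi_inverse (w *\<^sub>C (?h * ?h)) ((1/2) *\<^sub>C (a + c))"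
    "quasi_inverse (w *\<^sub>C (?h' * ?h')) ((1/2) *\<^sub>C (b + d))"
    using quasi_inverse_square[OF ab(3) cd(3)] quasi_inverse_square[OF ab(4) cd(4)]
    by (simp_all add: square_scaleC)
  moreover have "p ((1/2) *\<^sub>C (a + c) - (1/2) *\<^sub>C (b + d)) \<le> e"
  proof -
    have "(1/2) *\<^sub>C (a + c) - (1/2) *\<^sub>C (b + d) = (1/2) *\<^sub>C ((a - b) + (c - d))"
      by (simp add: scaleC.scale_right_diff_distrib scaleC.scale_right_distrib algebra_simps)
    then have "p ((1/2) *\<^sub>C (a + c) - (1/2) *\<^sub>C (b + d)) = 1/2 * p ((a - b) + (c - d))"
      using ab cd p_scaleC[of "(a - b) + (c - d)" "1/2"] by simp
    with p_triangle[of "a - b" "c - d"] ab cd show ?thesis by simp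
  qed
  moreover have "(1/2) *\<^sub>C (a + c) \<in> B" "(1/2) *\<^sub>C (b + d) \<in> B" using ab cd by simp_all
  ultimately show ?case unfolding funpow.simps comp_apply by blast
qed

lemma p_lipschitz_scaleC:
  assumes "h \<in> B"
  shows "p (v *\<^sub>C h - w *\<^sub>C h) = cmod (v - w) * p h"
  using p_scaleC[OF assms, of "v - w"] unfolding scaleC.scale_left_diff_distrib .

text \<open>The resolvent estimate bounds p (q w) - p (q v) by a product containing both values.
  Passing to reciprocals turns it into a 1-Lipschitz bound, and a positive continuous function on
  the compact disc has a positive minimum.\<close>

lemma resolvent_bounded:
  assumes h: "h \<in> B" "p h = 1"
    and q: "\<And>w. cmod w \<le> 1 \<Longrightarrow> q w \<in> B \<and> quasi_inverse (w *\<^sub>C h) (q w)"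
  shows "\<exists>M>0. \<forall>w. cmod w \<le> 1 \<longrightarrow> 1 + p (q w) \<le> M"
proof -
  define m where "m = (\<lambda>w. inverse (1 + p (q w)))"
  have pos: "1 + p (q w) > 0" if "cmod w \<le> 1" for w
    using q[OF that] p_nonneg[of "q w"] by linarith
  have lip: "m v - m w \<le> cmod (v - w)" if "cmod v \<le> 1" "cmod w \<le> 1" for v w
  proof -
    let ?v = "1 + p (q v)" and ?w = "1 + p (q w)"
    have "p (q w) \<le> p (q v) + p (q w - q v)"
      using p_triangle[of "q v" "q w - q v"] q that by simp
    also have "p (q w - q v) \<le> cmod (v - w) * ?v * ?w"
      using p_resolvent_le[of "v *\<^sub>C h" "w *\<^sub>C h" "q v" "q w"] q that h
      by (simp add: p_lipschitz_scaleC)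
    finally have "?w - ?v \<le> cmod (v - w) * (?v * ?w)" by (simp add: mult.assoc)
    moreover have "m v - m w = (?w - ?v) / (?v * ?w)"
      using pos[OF that(1)] pos[OF that(2)] by (simp add: m_def field_simps)
    ultimately show ?thesis
      using pos[OF that(1)] pos[OF that(2)] by (simp add: pos_divide_le_eq)
  qed
  have "continuous_on (cball 0 1) m"
  proof -
    have "dist (m v) (m w) \<le> 1 * dist v w" if "v \<in> cball 0 1" "w \<in> cball 0 1" for v w
      using lip[of v w] lip[of w v] that by (simp add: dist_norm norm_minus_commute abs_le_iff)
    then have "1-lipschitz_on (cball 0 1) m" by (intro lipschitz_onI) auto
    then show ?thesis by (rule lipschitz_on_continuous_on)
  qed
  then obtain w0 where w0: "cmod w0 \<le> 1" "\<And>w. cmod w \<le> 1 \<Longrightarrow> m w0 \<le> m w"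
    using continuous_attains_inf[of "cball 0 (1::real)" m] by auto
  show ?thesis
  proof (intro exI conjI allI impI)
    show "0 < 1 + p (q w0)" using pos w0 by blast
    fix w assume "cmod w \<le> 1"
    then have "inverse (1 + p (q w0)) \<le> inverse (1 + p (q w))"
      using w0(2) by (simp add: m_def)
    then show "1 + p (q w) \<le> 1 + p (q w0)"
      by (rule inverse_le_imp_le) (rule pos[OF w0(1)])
  qed
qed

text \<open>Otherwise the quasi-inverses for h and for the slightly smaller (1 - t) h are close on
  the unit circle, hence so are those for their iterated squares. But the iterated squares of h keep
  norm 1 while the others tend to 0.\<close>

lemma not_quasi_invertible_unit:
  assumes h: "h \<in> B" "star h = h" "p h = 1"
  shows "\<exists>w. cmod w \<le> 1 \<and> \<not> quasi_invertible B (w *\<^sub>C h)"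
proof (rule ccontr)
  assume "\<not> ?thesis"
  then have "\<forall>w. \<exists>q. cmod w \<le> 1 \<longrightarrow> q \<in> B \<and> quasi_inverse (w *\<^sub>C h) q"
    by (auto simp: quasi_invertible_def)
  then obtain q where q: "\<And>w. cmod w \<le> 1 \<Longrightarrow> q w \<in> B \<and> quasi_inverse (w *\<^sub>C h) (q w)"
    by metis
  obtain M where M: "M > 0" "\<And>w. cmod w \<le> 1 \<Longrightarrow> 1 + p (q w) \<le> M"
    using resolvent_bounded[OF h(1,3) q] by blast
  \<comment> \<open>Moving w by t changes the quasi-inverse by at most t M ^ 2, which should not
    exceed 1/8; t \<le> 1/2 keeps 1 - t positive.\<close>
  define t where "t = min (1/2) (1 / (8 * M\<^sup>2))"
  have t: "0 < t" "t \<le> 1/2" "t * M\<^sup>2 \<le> 1/8"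
  proof -
    show "0 < t" "t \<le> 1/2" using M by (auto simp: t_def)
    have "t \<le> 1 / (8 * M\<^sup>2)" by (simp add: t_def)
    then show "t * M\<^sup>2 \<le> 1/8" using M by (simp add: field_simps)
  qed
  define s where "s = 1 - t"
  define h' where "h' = complex_of_real s *\<^sub>C h"
  have s: "0 < s" "s < 1" using t by (auto simp: s_def)
  have h': "h' \<in> B" "star h' = h'" "p h' = s"
    using h s by (auto simp: h'_def star_scaleC p_scaleC)
  have base: "\<exists>a\<in>B. \<exists>b\<in>B. quasi_inverse (w *\<^sub>C h) a \<and> quasi_inverse (w *\<^sub>C h') b \<and> p (a - b) \<le> 1/8"
    if w: "cmod w = 1" for w
  proof -
    let ?w = "w * complex_of_real s"
    have w': "cmod ?w \<le> 1" "w *\<^sub>C h' = ?w *\<^sub>C h" using w s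
      by (simp_all add: norm_mult h'_def scaleC_simps)
    have "cmod (?w - w) = t"
    proof -
      have "?w - w = - (w * complex_of_real t)" by (simp add: s_def algebra_simps)
      then show ?thesis using w t by (simp add: norm_mult)
    qed
    then have "p (q w - q ?w) \<le> t * (1 + p (q ?w)) * (1 + p (q w))"
      using p_resolvent_le[of "?w *\<^sub>C h" "w *\<^sub>C h" "q ?w" "q w"] q w w' h
      by (simp add: p_lipschitz_scaleC)
    also have "\<dots> \<le> t * M * M"
      using M t w w' q by (intro mult_mono) auto
    also have "\<dots> \<le> 1/8" using t(3) by (simp add: power2_eq_square)
    finally have "p (q w - q ?w) \<le> 1/8" .
    moreover have "q w \<in> B" "quasi_inverse (w *\<^sub>C h) (q w)" using q w by simp_all
    moreover have "q ?w \<in> B" "quasi_inverse (w *\<^sub>C h') (q ?w)"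
      unfolding w'(2) using q[OF w'(1)] by simp_all
    ultimately show ?thesis by blast
  qed
  have "(\<lambda>n. s ^ n) \<longlonglongrightarrow> 0" using s by (intro LIMSEQ_realpow_zero) auto
  then have "\<forall>\<^sub>F n in sequentially. s ^ n < 1/16" by (rule order_tendstoD) simp
  then obtain n where n: "s ^ n < 1/16" by (auto simp: eventually_sequentially)
  let ?S = "(\<lambda>x. x * x) ^^ n"
  obtain a b where ab: "a \<in> B" "b \<in> B" "quasi_inverse (?S h) a" "quasi_inverse (?S h') b"
      "p (a - b) \<le> 1/8"
    using quasi_inverse_funpow_close[OF h(1) h'(1) base, of 1 n] by (auto simp: scaleC_one)
  have "p (?S h') = s ^ (2 ^ n)" using funpow_square[OF h'(1,2), of n] h' by simp
  also have "\<dots> \<le> s ^ n" using s by (intro power_decreasing) auto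
  also note n
  finally have "p (?S h') < 1/16" .
  then have "p b \<le> 1/8"
    using p_quasi_inverse_le[of "?S h'" b] ab funpow_square(1)[OF h'(1,2), of n] by simp
  then have "p a \<le> 1/4" using p_triangle[of "a - b" b] ab by simp
  have S1: "?S h \<in> B" "p (?S h) = 1" using funpow_square[OF h(1,2), of n] h by auto
  have "?S h = ?S h * a - a" using quasi_inverseD[OF ab(3)] by simp
  then have "1 \<le> p (?S h * a) + p a"
    using p_triangle_diff[of "?S h * a" a] ab S1 by auto
  also have "p (?S h * a) \<le> p a" using p_mult[of "?S h" a] ab S1 by simp
  finally show False using \<open>p a \<le> 1/4\<close> by simp
qed

text \<open>Here 1 / w is a spectral value relative to \<open>B\<close> of modulus at least p h; w
  is nonzero because 0 is quasi-invertible.\<close>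

lemma not_quasi_invertible_self_adjoint:
  assumes h: "h \<in> B" "star h = h" "h \<noteq> 0"
  shows "\<exists>w. cmod w * p h \<le> 1 \<and> \<not> quasi_invertible B (w *\<^sub>C h)"
proof -
  have pos: "p h > 0" using h p_eq_0_iff[of h] p_nonneg[of h] by linarith
  let ?c = "complex_of_real (inverse (p h))"
  have "?c *\<^sub>C h \<in> B" "star (?c *\<^sub>C h) = ?c *\<^sub>C h" "p (?c *\<^sub>C h) = 1"
    using h pos by (auto simp del: of_real_inverse simp: star_scaleC p_scaleC)
  from not_quasi_invertible_unit[OF this] obtain w where
    "cmod w \<le> 1" "\<not> quasi_invertible B (w *\<^sub>C ?c *\<^sub>C h)" by blast
  then show ?thesis using pos
    by (intro exI[of _ "w * ?c"]) (simp add: scaleC_scaleC norm_mult norm_inverse mult.assoc)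
qed

end

subsection \<open>Polynomials of self-adjoint elements\<close>

text \<open>\<open>poly_calc k q\<close> is the value at \<open>k\<close> of the polynomial \<open>t q(t)\<close>, whose missing constant term
  makes it meaningful without a unit.\<close>

definition poly_calc :: "'a::cstar_algebra \<Rightarrow> complex poly \<Rightarrow> 'a" where
  "poly_calc k q = fold_coeffs (\<lambda>c y. c *\<^sub>C k + k * y) q 0"

lemma poly_calc_0 [simp]: "poly_calc k 0 = 0"
  by (simp add: poly_calc_def)

lemma poly_calc_pCons [simp]: "poly_calc k (pCons c q) = c *\<^sub>C k + k * poly_calc k q"
  by (cases "c = 0 \<and> q = 0") (auto simp: poly_calc_def)

lemma poly_calc_add: "poly_calc k (q + r) = poly_calc k q + poly_calc k r"
  by (induction q r rule: poly_induct2) (simp_all add: scaleC_add_left algebra_simps)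

lemma poly_calc_smult: "poly_calc k (smult c q) = c *\<^sub>C poly_calc k q"
  by (induction q) (simp_all add: scaleC_add_right scaleC_scaleC mult_scaleC_right)

lemma poly_calc_minus: "poly_calc k (- q) = - poly_calc k q"
  using poly_calc_smult[of k "-1" q] by (simp add: scaleC_one)

lemma poly_calc_diff: "poly_calc k (q - r) = poly_calc k q - poly_calc k r"
  using poly_calc_add[of k q "- r"] by (simp add: poly_calc_minus)

lemma poly_calc_commute: "poly_calc k q * k = k * poly_calc k q"
  by (induction q)
    (simp_all add: distrib_left distrib_right mult.assoc mult_scaleC_left mult_scaleC_right)

lemma poly_calc_mult: "poly_calc k q * poly_calc k r = poly_calc k (pCons 0 (q * r))"
proof (induction q)
  case (pCons c q)
  have "poly_calc k (pCons c q) * poly_calc k r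
      = c *\<^sub>C (k * poly_calc k r) + k * (poly_calc k q * poly_calc k r)"
    by (simp add: distrib_right mult_scaleC_left mult.assoc)
  then show ?case
    by (simp add: pCons.IH poly_calc_add poly_calc_smult distrib_left mult_scaleC_right)
qed simp

lemma star_poly_calc:
  assumes "star k = k" "\<And>i. coeff q i \<in> \<real>"
  shows "star (poly_calc k q) = poly_calc k q"
  using assms(2)
proof (induction q)
  case 0
  show ?case by (simp add: star_zero)
next
  case (pCons c q)
  have "c \<in> \<real>" using pCons.prems[of 0] by simp
  moreover have "coeff q i \<in> \<real>" for i using pCons.prems[of "Suc i"] by simp
  ultimately show ?case
    using pCons.IH assms(1)
    by (simp add: star_add star_scaleC star_mult poly_calc_commute Reals_cnj_iff)
qed

lemma circ_poly_calc:
  "circ (poly_calc k q) (poly_calc k r) = poly_calc k (q + r - pCons 0 (q * r))"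
  by (simp add: circ_def poly_calc_mult poly_calc_add poly_calc_diff)

section \<open>Spectral mapping for polynomials without constant term\<close>

text \<open>In terms of \<open>1 - t q(t)\<close> this splits off the linear factor \<open>1 - t / z\<close>.\<close>

lemma split_off_root:
  assumes "z * poly q z = (1::complex)"
  obtains s where "q = [:inverse z:] + s - pCons 0 ([:inverse z:] * s)"
    "degree (pCons 1 (- s)) < degree (pCons 1 (- q))"
proof -
  have z: "z \<noteq> 0" using assms by auto
  \<comment> \<open>z is a root of 1 - t q(t), so t - z divides it; scaling the cofactor r to
    constant term 1 gives 1 - t s(t) with s = z s0.\<close>
  have "poly (pCons 1 (- q)) z = 0" using assms by simp
  then obtain r where r: "pCons 1 (- q) = [:- z, 1:] * r"
    unfolding poly_eq_0_iff_dvd by (auto elim: dvdE)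
  obtain a s0 where a: "r = pCons a s0" by (cases r)
  have eq: "pCons 1 (- q) = pCons (- z * a) (- smult z s0 + r)"
    unfolding r a by simp
  then have "- z * a = 1" "- q = - smult z s0 + r" by auto
  then have az: "a = - inverse z" and "q = smult z s0 - r"
    using z by (auto simp: field_simps minus_equation_iff)
  then have "q = [:inverse z:] + smult z s0 - pCons 0 ([:inverse z:] * smult z s0)"
    using z by (simp add: a)
  moreover have "degree (pCons 1 (- smult z s0)) < degree (pCons 1 (- q))"
  proof -
    have "r \<noteq> 0" using a az z by auto
    then have "degree (pCons 1 (- q)) = Suc (degree r)"
      unfolding r by (subst degree_mult_eq) auto
    moreover have "degree r = degree (pCons 1 (- smult z s0))"
      using z by (simp add: a)
    ultimately show ?thesis by simp
  qed
  ultimately show ?thesis by (rule that)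
qed

text \<open>Over the complex numbers 1 - t q(t) splits into factors 1 - t / z, each quasi-invertible
  at k by hypothesis; induction on the degree removes one factor at a time.\<close>

lemma quasi_invertible_poly_calc:
  assumes "\<And>z. z * poly q z = 1 \<Longrightarrow> quasi_invertible UNIV (inverse z *\<^sub>C k)"
  shows "quasi_invertible UNIV (poly_calc k q)"
  using assms
proof (induction "degree (pCons 1 (- q))" arbitrary: q rule: less_induct)
  case less
  show ?case
  proof (cases "q = 0")
    case True
    then show ?thesis using quasi_inverse_zero by (auto simp: quasi_invertible_def)
  next
    case False
    then have "\<exists>z. poly (pCons 1 (- q)) z = 0"
      by (intro fundamental_theorem_of_algebra_alt) auto
    then obtain z where z: "z * poly q z = 1" by auto
    then obtain s where s: "q = [:inverse z:] + s - pCons 0 ([:inverse z:] * s)"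
      "degree (pCons 1 (- s)) < degree (pCons 1 (- q))" by (rule split_off_root)
    have "quasi_invertible UNIV (inverse w *\<^sub>C k)" if "w * poly s w = 1" for w
    proof (rule less.prems)
      \<comment> \<open>This says 1 - w q(w) = (1 - w / z) (1 - w s(w)), so roots of the cofactor
        are roots of the original.\<close>
      have "w * poly q w = w * inverse z + (w * poly s w) * (1 - w * inverse z)"
        by (subst s(1)) (simp add: algebra_simps)
      then show "w * poly q w = 1" using that by simp
    qed
    then have "quasi_invertible UNIV (poly_calc k s)" by (rule less.hyps[OF s(2)])
    moreover have "quasi_invertible UNIV (poly_calc k [:inverse z:])"
      using less.prems[OF z] by simp
    moreover have "poly_calc k q = circ (poly_calc k [:inverse z:]) (poly_calc k s)"
      unfolding circ_poly_calc using s(1) by simp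
    ultimately show ?thesis by (simp only: quasi_invertible_circ)
  qed
qed

text \<open>If c = z q(z) had modulus above the norm, 1 - \<open>poly_calc k q\<close> / c would be
  invertible, and then so would its commuting factor 1 - k / z.\<close>

lemma norm_poly_calc_ge:
  assumes "\<not> quasi_invertible UNIV (inverse z *\<^sub>C k)"
  shows "cmod (z * poly q z) \<le> norm (poly_calc k q)"
proof (rule ccontr)
  assume *: "\<not> ?thesis"
  define c where "c = z * poly q z"
  have c: "norm (poly_calc k q) < cmod c" using * by (simp add: c_def)
  then have "c \<noteq> 0" by auto
  have "norm (inverse c *\<^sub>C poly_calc k q) < 1"
    using c \<open>c \<noteq> 0\<close> by (simp add: norm_scaleC norm_inverse pos_divide_less_eq flip: divide_inverse_commute)
  then have qi: "quasi_invertible UNIV (poly_calc k (smult (inverse c) q))"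
    unfolding poly_calc_smult by (rule quasi_invertible_norm_less_1)
  have "z * poly (smult (inverse c) q) z = 1"
    using \<open>c \<noteq> 0\<close> by (simp add: c_def field_simps)
  then obtain s where s: "smult (inverse c) q = [:inverse z:] + s - pCons 0 ([:inverse z:] * s)"
    by (rule split_off_root)
  have "circ (poly_calc k [:inverse z:]) (poly_calc k s) = poly_calc k (smult (inverse c) q)"
    "circ (poly_calc k s) (poly_calc k [:inverse z:]) = poly_calc k (smult (inverse c) q)"
    unfolding circ_poly_calc s by (simp_all add: add.commute)
  then have "quasi_invertible UNIV (poly_calc k [:inverse z:])"
    using qi by (metis quasi_invertible_circ_left)
  with assms show False by simp
qed

section \<open>Reality of the spectrum of self-adjoint elements\<close>

text \<open>On the spectrum of \<open>h\<close>, the polynomials \<open>t (1 + \<i> l t) ^ n\<close> grow faster than their norms at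
  \<open>h\<close> if the spectrum has a point off the real axis.\<close>

lemma norm_poly_calc_power_le:
  fixes h :: "'a::cstar_algebra"
  assumes h: "star h = h"
  shows "(norm (poly_calc h ([:1, \<i> * complex_of_real l:] ^ n)))\<^sup>2
    \<le> (1 + l\<^sup>2 * (norm h)\<^sup>2) ^ n * (norm h)\<^sup>2"
proof (induction n)
  case 0
  then show ?case by (simp add: scaleC_one one_pCons)
next
  case (Suc n)
  let ?l = "\<i> * complex_of_real l"
  define y where "y = poly_calc h ([:1, ?l:] ^ n)"
  have 1: "poly_calc h ([:1, ?l:] ^ Suc n) = y + ?l *\<^sub>C (h * y)"
    by (simp add: y_def poly_calc_add poly_calc_smult mult_scaleC_right)
  \<comment> \<open>The cross terms cancel: formally (1 - i l h) (1 + i l h) = 1 + l ^ 2 h ^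
    2.\<close>
  have "star (y + ?l *\<^sub>C (h * y)) * (y + ?l *\<^sub>C (h * y))
      = star y * y + complex_of_real (l\<^sup>2) *\<^sub>C (star (h * y) * (h * y))"
    by (simp add: star_add star_scaleC star_mult h algebra_simps mult_scaleC_left mult_scaleC_right
        scaleC_scaleC scaleC.scale_minus_left power2_eq_square)
  then have "(norm (y + ?l *\<^sub>C (h * y)))\<^sup>2
      = norm (star y * y + complex_of_real (l\<^sup>2) *\<^sub>C (star (h * y) * (h * y)))"
    by (metis norm_star_mult_self)
  also have "\<dots> \<le> (norm y)\<^sup>2 + l\<^sup>2 * (norm (h * y))\<^sup>2"
    by (rule norm_triangle_le) (simp add: norm_scaleC norm_star_mult_self norm_power del: of_real_power)
  also have "\<dots> \<le> (norm y)\<^sup>2 + l\<^sup>2 * (norm h * norm y)\<^sup>2"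
    by (intro add_left_mono mult_left_mono power_mono norm_mult_ineq) auto
  also have "\<dots> = (1 + l\<^sup>2 * (norm h)\<^sup>2) * (norm y)\<^sup>2"
    by (simp add: algebra_simps power_mult_distrib)
  also have "\<dots> \<le> (1 + l\<^sup>2 * (norm h)\<^sup>2) * ((1 + l\<^sup>2 * (norm h)\<^sup>2) ^ n * (norm h)\<^sup>2)"
    using Suc by (intro mult_left_mono) (auto simp: y_def)
  finally show ?case unfolding 1 by (simp add: mult.assoc)
qed

lemma self_adjoint_spectrum_real:
  fixes h :: "'a::cstar_algebra"
  assumes h: "star h = h" and z: "\<not> quasi_invertible UNIV (inverse z *\<^sub>C h)"
  shows "Im z = 0"
proof (rule ccontr)
  assume im: "Im z \<noteq> 0"
  then have "z \<noteq> 0" by auto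
  define N where "N = 1 + (norm h)\<^sup>2"
  \<comment> \<open>This l makes - l Im z = l ^ 2 N, hence A \<ge> 1 - 2 l Im z = 1 + 2 l ^ 2 N > C,
    and the powers of A outgrow those of C, against \<open>bound\<close>.\<close>
  define l where "l = - Im z / N"
  define A where "A = (cmod (1 + \<i> * complex_of_real l * z))\<^sup>2"
  define C where "C = 1 + l\<^sup>2 * (norm h)\<^sup>2"
  have N: "N > 0" by (simp add: N_def add_pos_nonneg)
  have C: "C > 0" by (simp add: C_def add_pos_nonneg)
  have bound: "(cmod z)\<^sup>2 * A ^ n \<le> C ^ n * (norm h)\<^sup>2" for n
  proof -
    have "cmod (z * (1 + \<i> * complex_of_real l * z) ^ n)
        \<le> norm (poly_calc h ([:1, \<i> * complex_of_real l:] ^ n))"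
      using norm_poly_calc_ge[OF z, of "[:1, \<i> * complex_of_real l:] ^ n"]
      by (simp add: poly_power algebra_simps)
    then have "(cmod (z * (1 + \<i> * complex_of_real l * z) ^ n))\<^sup>2
        \<le> (norm (poly_calc h ([:1, \<i> * complex_of_real l:] ^ n)))\<^sup>2"
      by (intro power_mono) auto
    also note norm_poly_calc_power_le[OF h]
    finally show ?thesis
      by (simp add: A_def C_def norm_mult norm_power power_mult_distrib power_mult[symmetric] mult.commute)
  qed
  have "C < A"
  proof -
    have "A = (1 - l * Im z)\<^sup>2 + (l * Re z)\<^sup>2"
      by (simp add: A_def cmod_power2)
    also have "\<dots> = 1 - 2 * l * Im z + l\<^sup>2 * (cmod z)\<^sup>2"
      unfolding cmod_power2 by (simp add: power2_eq_square algebra_simps)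
    finally have "A \<ge> 1 - 2 * l * Im z" by simp
    moreover have "l * Im z = - (l\<^sup>2 * N)" using N by (simp add: l_def power2_eq_square)
    moreover have "l\<^sup>2 * N > 0" using N im by (simp add: l_def)
    ultimately have "A > 1 + l\<^sup>2 * N" by linarith
    moreover have "l\<^sup>2 * N = l\<^sup>2 + l\<^sup>2 * (norm h)\<^sup>2" by (simp add: N_def distrib_left)
    ultimately show ?thesis using zero_le_power2[of l] unfolding C_def by linarith
  qed
  then have "1 < A / C" using C by simp
  then obtain n where "(norm h)\<^sup>2 / (cmod z)\<^sup>2 < (A / C) ^ n"
    using real_arch_pow by blast
  then have "C ^ n * (norm h)\<^sup>2 < (cmod z)\<^sup>2 * A ^ n"
    using C \<open>z \<noteq> 0\<close> by (simp add: power_divide divide_simps mult.commute)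
  with bound[of n] show False by simp
qed

text \<open>Being self-adjoint, \<open>poly_calc k q\<close> has a spectral value of modulus at
  least its norm. That value is z q(z) for some z in the spectrum of k, which is real and at most 1
  in modulus.\<close>

lemma norm_poly_calc_le:
  fixes k :: "'a::cstar_algebra"
  assumes k: "star k = k" "norm k \<le> 1" and q: "\<And>i. coeff q i \<in> \<real>"
    and M: "\<And>t. \<bar>t\<bar> \<le> 1 \<Longrightarrow> \<bar>t\<bar> * cmod (poly q (complex_of_real t)) \<le> M"
  shows "norm (poly_calc k q) \<le> M"
proof (rule ccontr)
  assume M': "\<not> ?thesis"
  interpret normed_star_subalgebra "UNIV :: 'a set" norm
    by unfold_locales (simp_all add: star_subalgebra_UNIV cstar_norm_on_norm)
  have "poly_calc k q \<noteq> 0" using M' M[of 0] by auto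
  then obtain w where w: "cmod w * norm (poly_calc k q) \<le> 1"
    "\<not> quasi_invertible UNIV (poly_calc k (smult w q))"
    using not_quasi_invertible_self_adjoint[of "poly_calc k q"] star_poly_calc[OF k(1) q]
    by (auto simp: poly_calc_smult)
  then obtain z where z: "z * poly (smult w q) z = 1" "\<not> quasi_invertible UNIV (inverse z *\<^sub>C k)"
    using quasi_invertible_poly_calc by blast
  obtain t where t: "z = complex_of_real t"
    using self_adjoint_spectrum_real[OF k(1) z(2)] complex_is_Real_iff Reals_cases by metis
  have "t \<noteq> 0" "w \<noteq> 0" using z t by auto
  have "1 \<le> norm (inverse z *\<^sub>C k)"
    using z(2) quasi_invertible_norm_less_1 by (meson not_le)
  then have "\<bar>t\<bar> \<le> norm k"
    using \<open>t \<noteq> 0\<close>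
    by (simp add: t norm_scaleC norm_inverse pos_le_divide_eq flip: divide_inverse_commute)
  with k have "\<bar>t\<bar> * cmod (poly q (complex_of_real t)) \<le> M" by (intro M) simp
  then have "cmod w * (\<bar>t\<bar> * cmod (poly q (complex_of_real t))) \<le> cmod w * M"
    by (intro mult_left_mono) auto
  moreover have "cmod w * (\<bar>t\<bar> * cmod (poly q (complex_of_real t))) = 1"
    using arg_cong[OF z(1), of cmod] by (simp add: t norm_mult mult_ac)
  moreover have "cmod w * M < cmod w * norm (poly_calc k q)"
    using M' \<open>w \<noteq> 0\<close> by simp
  ultimately show False using w(1) by linarith
qed

subsection \<open>Minimality of the C*-norm\<close>

lemma real_poly_approx:
  fixes F :: "real \<Rightarrow> real"
  assumes "continuous_on {-1..1} F" "0 < e"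
  obtains q :: "complex poly" where "\<And>i. coeff q i \<in> \<real>"
    "\<And>t. \<bar>t\<bar> \<le> 1 \<Longrightarrow> cmod (poly q (complex_of_real t) - complex_of_real (F t)) < e"
proof -
  obtain g where g: "real_polynomial_function g" "\<And>t. t \<in> {-1..1} \<Longrightarrow> \<bar>F t - g t\<bar> < e"
    using Stone_Weierstrass_real_polynomial_function[OF _ assms] by auto
  then obtain a n where a: "g = (\<lambda>t. \<Sum>i\<le>n. a i * t ^ i)"
    using real_polynomial_function_imp_sum by blast
  define q where "q = (\<Sum>i\<le>n. monom (complex_of_real (a i)) i)"
  have q: "poly q (complex_of_real t) = complex_of_real (g t)" for t
    by (simp add: q_def a poly_sum poly_monom)
  show ?thesis
  proof
    show "coeff q i \<in> \<real>" for i
      by (auto simp: q_def coeff_sum intro!: sum_in_Reals)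
    show "cmod (poly q (complex_of_real t) - complex_of_real (F t)) < e" if "\<bar>t\<bar> \<le> 1" for t
      using g(2)[of t] that
      by (simp add: q abs_minus_commute abs_le_iff flip: of_real_diff)
  qed
qed

text \<open>The limit \<open>f\<close> is the value at \<open>k\<close> of the function \<open>t F(t)\<close>.\<close>

lemma continuous_calc:
  fixes k :: "'a::cstar_algebra"
  assumes k: "star k = k" "norm k \<le> 1" and F: "continuous_on {-1..1} F"
  obtains q f where "\<And>n i. coeff (q n) i \<in> \<real>"
    "\<And>n t. \<bar>t\<bar> \<le> 1 \<Longrightarrow> cmod (poly (q n) (complex_of_real t) - complex_of_real (F t)) < inverse (Suc n)"
    "(\<lambda>n. poly_calc k (q n)) \<longlonglongrightarrow> f"
proof -
  have "\<exists>q. (\<forall>i. coeff q i \<in> \<real>) \<and> (\<forall>t. \<bar>t\<bar> \<le> 1 \<longrightarrow>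
      cmod (poly q (complex_of_real t) - complex_of_real (F t)) < inverse (Suc n))" for n
    by (rule real_poly_approx[OF F, of "inverse (Suc n)"]) auto
  then obtain q where q: "\<And>n i. coeff (q n) i \<in> \<real>"
    "\<And>n t. \<bar>t\<bar> \<le> 1 \<Longrightarrow> cmod (poly (q n) (complex_of_real t) - complex_of_real (F t)) < inverse (Suc n)"
    by metis
  \<comment> \<open>\<open>norm_poly_calc_le\<close> turns uniform errors on [-1, 1] into norm
    errors, as |t| \<le> 1 absorbs the factor t.\<close>
  have diff: "norm (poly_calc k (q m) - poly_calc k (q n)) \<le> inverse (Suc m) + inverse (Suc n)" for m n
    unfolding poly_calc_diff[symmetric]
  proof (rule norm_poly_calc_le[OF k])
    show "coeff (q m - q n) i \<in> \<real>" for i using q(1) by (simp add: Reals_diff)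
    fix t :: real assume t: "\<bar>t\<bar> \<le> 1"
    have "cmod (poly (q m - q n) (complex_of_real t))
        = cmod ((poly (q m) (complex_of_real t) - complex_of_real (F t))
          - (poly (q n) (complex_of_real t) - complex_of_real (F t)))" by simp
    also have "\<dots> \<le> inverse (Suc m) + inverse (Suc n)"
      using q(2)[OF t, of m] q(2)[OF t, of n] norm_triangle_ineq4
      by (meson add_mono less_imp_le order_trans)
    finally have "\<bar>t\<bar> * cmod (poly (q m - q n) (complex_of_real t)) \<le> 1 * (inverse (Suc m) + inverse (Suc n))"
      using t by (intro mult_mono) auto
    then show "\<bar>t\<bar> * cmod (poly (q m - q n) (complex_of_real t)) \<le> inverse (Suc m) + inverse (Suc n)"
      by simp
  qed
  have "Cauchy (\<lambda>n. poly_calc k (q n))"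
  proof (rule metric_CauchyI)
    fix e :: real assume "0 < e"
    then obtain N where N: "inverse (Suc N) < e / 2" using reals_Archimedean[of "e / 2"] by auto
    have "dist (poly_calc k (q m)) (poly_calc k (q n)) < e" if "m \<ge> N" "n \<ge> N" for m n
    proof -
      have "inverse (real (Suc m)) \<le> inverse (Suc N)" "inverse (real (Suc n)) \<le> inverse (Suc N)"
        using that by (auto intro!: le_imp_inverse_le)
      with diff[of m n] N show ?thesis by (simp only: dist_norm)
    qed
    then show "\<exists>M. \<forall>m\<ge>M. \<forall>n\<ge>M. dist (poly_calc k (q m)) (poly_calc k (q n)) < e" by blast
  qed
  then obtain f where "(\<lambda>n. poly_calc k (q n)) \<longlonglongrightarrow> f"
    using Cauchy_convergent_iff convergent_def by blast
  with q show ?thesis by (rule that)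
qed

lemma Reals_coeff_mult:
  "(\<And>i. coeff q i \<in> \<real>) \<Longrightarrow> (\<And>i. coeff r i \<in> \<real>) \<Longrightarrow> coeff (q * r) i \<in> (\<real> :: complex set)"
  by (auto simp: coeff_mult intro!: sum_in_Reals Reals_mult)

text \<open>\<open>f\<close> and \<open>g\<close> are functions of \<open>k\<close> supported near the spectral value \<open>1\<close>, with \<open>g = 1\<close> on the
  support of \<open>f\<close>.\<close>

lemma exists_local_unit:
  fixes k :: "'a::cstar_algebra"
  assumes k: "star k = k" "norm k \<le> 1" and inv: "\<not> quasi_invertible UNIV k"
    and e: "0 < e" "e \<le> 1/4"
  shows "\<exists>f g. f \<noteq> 0 \<and> g * f = f \<and> norm (g - k * g) \<le> 2 * e"
proof -
  \<comment> \<open>The function t G(t) rises from 0 at 1 - 2 e to 1 at 1 - e, beyond which F is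
    positive. Since e \<le> 1/4, \<open>max t (1/2)\<close> equals t wherever the numerator is
    nonzero.\<close>
  define F where "F = (\<lambda>t::real. max 0 (t - (1 - e)))"
  define G where "G = (\<lambda>t::real. max 0 (min 1 ((t - (1 - 2 * e)) / e)) / max t (1/2))"
  have contF: "continuous_on {-1..1} F" unfolding F_def by (intro continuous_intros)
  have contG: "continuous_on {-1..1} G" unfolding G_def using e by (intro continuous_intros) auto
  have tG: "t * G t = max 0 (min 1 ((t - (1 - 2 * e)) / e))" for t
  proof (cases "t \<ge> 1 - 2 * e")
    case True
    then show ?thesis using e by (simp add: G_def max_def)
  next
    case False
    then have "(t - (1 - 2 * e)) / e \<le> 0" using e by (simp add: divide_le_0_iff)
    then show ?thesis by (simp add: G_def)
  qed
  have tG1: "\<bar>t * G t\<bar> \<le> 1" for t by (auto simp: tG)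
  have GF: "t * G t * F t = F t" for t
  proof (cases "t \<ge> 1 - e")
    case True
    then have "(t - (1 - 2 * e)) / e \<ge> 1" using e by (simp add: pos_le_divide_eq)
    then show ?thesis by (simp add: tG)
  qed (simp add: F_def)
  have F1: "\<bar>F t\<bar> \<le> 1" if "\<bar>t\<bar> \<le> 1" for t using that e by (auto simp: F_def)
  have G1: "\<bar>(1 - t) * (t * G t)\<bar> \<le> 2 * e" if "\<bar>t\<bar> \<le> 1" for t
  proof (cases "t \<ge> 1 - 2 * e")
    case True
    have "\<bar>(1 - t) * (t * G t)\<bar> \<le> 2 * e * 1"
      unfolding abs_mult[of "1 - t"] using tG1 True that e by (intro mult_mono) auto
    then show ?thesis by simp
  next
    case False
    then have "(t - (1 - 2 * e)) / e \<le> 0" using e by (simp add: divide_le_0_iff)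
    then show ?thesis using e by (simp add: tG)
  qed
  obtain q f where q: "\<And>n i. coeff (q n) i \<in> \<real>"
    "\<And>n t. \<bar>t\<bar> \<le> 1 \<Longrightarrow> cmod (poly (q n) (complex_of_real t) - complex_of_real (F t)) < inverse (Suc n)"
    "(\<lambda>n. poly_calc k (q n)) \<longlonglongrightarrow> f"
    using continuous_calc[OF k contF] by metis
  obtain r g where r: "\<And>n i. coeff (r n) i \<in> \<real>"
    "\<And>n t. \<bar>t\<bar> \<le> 1 \<Longrightarrow> cmod (poly (r n) (complex_of_real t) - complex_of_real (G t)) < inverse (Suc n)"
    "(\<lambda>n. poly_calc k (r n)) \<longlonglongrightarrow> g"
    using continuous_calc[OF k contG] by metis
  have d0: "(\<lambda>n. inverse (real (Suc n))) \<longlonglongrightarrow> 0" by (rule LIMSEQ_inverse_real_of_nat)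
  have d1: "inverse (real (Suc n)) \<le> 1" for n by (simp add: field_simps)
  \<comment> \<open>1 is a spectral value of k, so \<open>norm_poly_calc_ge\<close> bounds norm f
    below by F 1 = e, the limit of the values at 1.\<close>
  have "norm f \<ge> e"
  proof (rule LIMSEQ_le)
    show "(\<lambda>n. e - inverse (Suc n)) \<longlonglongrightarrow> e" using tendsto_diff[OF tendsto_const d0, of e] by simp
    show "(\<lambda>n. norm (poly_calc k (q n))) \<longlonglongrightarrow> norm f" using q(3) by (rule tendsto_norm)
    have "e - inverse (Suc n) \<le> norm (poly_calc k (q n))" for n
    proof -
      have "cmod (poly (q n) 1) \<le> norm (poly_calc k (q n))"
        using norm_poly_calc_ge[of 1 k "q n"] inv by (simp add: scaleC_one)
      moreover have "cmod (poly (q n) 1 - complex_of_real e) < inverse (Suc n)"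
        using q(2)[of 1 n] e by (simp add: F_def)
      moreover have "e = cmod (complex_of_real e)" using e by simp
      ultimately show ?thesis
        using norm_triangle_ineq2[of "complex_of_real e" "poly (q n) 1"]
        by (simp add: norm_minus_commute del: of_nat_Suc)
    qed
    then show "\<exists>N. \<forall>n\<ge>N. e - inverse (Suc n) \<le> norm (poly_calc k (q n))" by blast
  qed
  then have "f \<noteq> 0" using e by auto
  moreover have "norm (g * f - f) \<le> 0"
  proof (rule LIMSEQ_le)
    show "(\<lambda>n. norm (poly_calc k (r n) * poly_calc k (q n) - poly_calc k (q n))) \<longlonglongrightarrow> norm (g * f - f)"
      by (intro tendsto_intros q r)
    show "(\<lambda>n. 4 * inverse (Suc n)) \<longlonglongrightarrow> 0" using tendsto_mult[OF tendsto_const d0, of 4] by simp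
    have "norm (poly_calc k (r n) * poly_calc k (q n) - poly_calc k (q n)) \<le> 4 * inverse (Suc n)" for n
      unfolding poly_calc_mult poly_calc_diff[symmetric]
    proof (rule norm_poly_calc_le[OF k])
      show "coeff (pCons 0 (r n * q n) - q n) i \<in> \<real>" for i
        using q(1) Reals_coeff_mult[OF r(1) q(1), of n n]
        by (cases i) (auto intro!: Reals_diff simp: coeff_pCons)
      fix t :: real assume t: "\<bar>t\<bar> \<le> 1"
      let ?t = "complex_of_real t" and ?F = "complex_of_real (F t)" and ?G = "complex_of_real (G t)"
      let ?q = "poly (q n) ?t" and ?r = "poly (r n) ?t" and ?d = "inverse (real (Suc n))"
      have GF': "?t * ?G * ?F = ?F" using GF[of t] by (metis of_real_mult)
      have "poly (pCons 0 (r n * q n) - q n) ?t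
          = ?t * ?r * ?q - ?q" by simp
      \<comment> \<open>By t G(t) F(t) = F(t) only approximation errors remain; they contribute 2 d,
        d and d because |q| \<le> 2 and |t G(t)| \<le> 1.\<close>
      also have "\<dots> = ?t * (?r - ?G) * ?q + ?t * ?G * (?q - ?F) - (?q - ?F)"
        using GF' by (simp add: algebra_simps)
      also have "cmod \<dots> \<le> cmod (?t * (?r - ?G) * ?q) + cmod (?t * ?G * (?q - ?F)) + cmod (?q - ?F)"
        by (intro order_trans[OF norm_triangle_ineq4] add_right_mono norm_triangle_ineq)
      also have "\<dots> \<le> 1 * ?d * 2 + 1 * ?d + ?d"
      proof -
        have "cmod ?q \<le> cmod (?q - ?F) + cmod ?F"
          using norm_triangle_ineq[of "?q - ?F" ?F] by simp
        also have "\<dots> \<le> 2" using q(2)[OF t, of n] F1[OF t] d1[of n] by simp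
        finally have q2: "cmod ?q \<le> 2" .
        have "cmod (?t * (?r - ?G) * ?q) \<le> 1 * ?d * 2"
          unfolding norm_mult using q2 t less_imp_le[OF r(2)[OF t, of n]] by (intro mult_mono) auto
        moreover have "cmod (?t * ?G) \<le> 1" using tG1[of t] by (simp only: norm_of_real flip: of_real_mult)
        then have "cmod (?t * ?G * (?q - ?F)) \<le> 1 * ?d"
          unfolding norm_mult[of "?t * ?G"] using less_imp_le[OF q(2)[OF t, of n]] by (intro mult_mono) auto
        ultimately show ?thesis using q(2)[OF t, of n] by linarith
      qed
      finally have "\<bar>t\<bar> * cmod (poly (pCons 0 (r n * q n) - q n) ?t) \<le> 1 * (4 * ?d)"
        using t by (intro mult_mono) auto
      then show "\<bar>t\<bar> * cmod (poly (pCons 0 (r n * q n) - q n) ?t) \<le> 4 * ?d" by simp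
    qed
    then show "\<exists>N. \<forall>n\<ge>N. norm (poly_calc k (r n) * poly_calc k (q n) - poly_calc k (q n)) \<le> 4 * inverse (Suc n)"
      by blast
  qed
  then have "g * f = f" by simp
  moreover have "norm (g - k * g) \<le> 2 * e"
  proof (rule LIMSEQ_le)
    show "(\<lambda>n. norm (poly_calc k (r n) - k * poly_calc k (r n))) \<longlonglongrightarrow> norm (g - k * g)"
      by (intro tendsto_intros r)
    show "(\<lambda>n. 2 * e + 2 * inverse (Suc n)) \<longlonglongrightarrow> 2 * e"
      using tendsto_add[OF tendsto_const tendsto_mult[OF tendsto_const d0, of 2], of "2 * e"] by simp
    have "norm (poly_calc k (r n) - k * poly_calc k (r n)) \<le> 2 * e + 2 * inverse (Suc n)" for n
    proof -
      have "norm (poly_calc k (r n - pCons 0 (r n))) \<le> 2 * e + 2 * inverse (Suc n)"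
      proof (rule norm_poly_calc_le[OF k])
        show "coeff (r n - pCons 0 (r n)) i \<in> \<real>" for i
          using r(1) by (cases i) (auto intro!: Reals_diff)
        fix t :: real assume t: "\<bar>t\<bar> \<le> 1"
        let ?t = "complex_of_real t" and ?G = "complex_of_real (G t)"
        let ?r = "poly (r n) ?t" and ?d = "inverse (real (Suc n))"
        have "\<bar>t\<bar> * cmod (poly (r n - pCons 0 (r n)) ?t) = cmod (?t * (?r - ?t * ?r))"
          by (simp add: norm_mult)
        \<comment> \<open>On [-1, 1] the first term vanishes unless |1 - t| \<le> 2 e; the second is
          the approximation error.\<close>
        also have "?t * (?r - ?t * ?r) = complex_of_real ((1 - t) * (t * G t)) + ?t * (1 - ?t) * (?r - ?G)"
          by (simp add: algebra_simps)
        also have "cmod \<dots> \<le> 2 * e + 1 * 2 * ?d"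
        proof (rule norm_triangle_mono)
          show "cmod (complex_of_real ((1 - t) * (t * G t))) \<le> 2 * e"
            unfolding norm_of_real by (rule G1[OF t])
          have "cmod (1 - ?t) \<le> 2" using norm_triangle_ineq4[of 1 ?t] t by simp
          then show "cmod (?t * (1 - ?t) * (?r - ?G)) \<le> 1 * 2 * ?d"
            unfolding norm_mult using t less_imp_le[OF r(2)[OF t, of n]] by (intro mult_mono) auto
        qed
        finally show "\<bar>t\<bar> * cmod (poly (r n - pCons 0 (r n)) ?t) \<le> 2 * e + 2 * ?d" by simp
      qed
      then show ?thesis by (simp add: poly_calc_diff)
    qed
    then show "\<exists>N. \<forall>n\<ge>N. norm (poly_calc k (r n) - k * poly_calc k (r n)) \<le> 2 * e + 2 * inverse (Suc n)"
      by blast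
  qed
  ultimately show ?thesis by blast
qed

lemma norm_minimal:
  fixes P :: "'a::cstar_algebra \<Rightarrow> real"
  assumes P0: "\<And>x. 0 \<le> P x" "\<And>x. P x = 0 \<Longrightarrow> x = 0"
    and P_add: "\<And>x y. P (x + y) \<le> P x + P y"
    and P_mult: "\<And>x y. P (x * y) \<le> P x * P y"
    and P_scale: "\<And>c x. P (c *\<^sub>C x) = cmod c * P x"
    and P_le: "\<And>x. P x \<le> norm x"
    and h: "star h = h"
  shows "norm h \<le> P h"
proof (cases "h = 0")
  case True
  then show ?thesis using P0 by simp
next
  case False
  interpret normed_star_subalgebra "UNIV :: 'a set" norm
    by unfold_locales (simp_all add: star_subalgebra_UNIV cstar_norm_on_norm)
  obtain w where w: "cmod w * norm h \<le> 1" "\<not> quasi_invertible UNIV (w *\<^sub>C h)"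
    using not_quasi_invertible_self_adjoint[OF _ h False] by auto
  define k where "k = w *\<^sub>C h"
  have "w \<noteq> 0" using w(2) quasi_inverse_zero by (auto simp: quasi_invertible_def)
  \<comment> \<open>1 / w is a spectral value of h, hence real; so k = w h is self-adjoint, and 1
    lies in its spectrum.\<close>
  have "Im (inverse w) = 0"
    using self_adjoint_spectrum_real[OF h, of "inverse w"] w(2) by simp
  then have "w \<in> \<real>" by (metis Reals_inverse complex_is_Real_iff inverse_inverse_eq)
  then have k: "star k = k" "norm k \<le> 1"
    using w(1) by (simp_all add: k_def star_scaleC h norm_scaleC Reals_cnj_iff)
  have near_1: "1 - P k \<le> 2 * e" if e: "0 < e" "e \<le> 1/4" for e
  proof -
    obtain f g where fg: "f \<noteq> 0" "g * f = f" "norm (g - k * g) \<le> 2 * e"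
      using exists_local_unit[OF k _ e] w(2) by (auto simp: k_def)
    \<comment> \<open>As \<open>g\<close> acts as a unit on \<open>f\<close>, f - k f = (g - k g) f;
      dividing the resulting estimate by P f > 0 gives 1 - P k \<le> 2 e.\<close>
    have "f = (g - k * g) * f + k * f"
      using fg(2) by (simp add: left_diff_distrib mult.assoc)
    then have "P f \<le> P ((g - k * g) * f) + P (k * f)" by (metis P_add)
    also have "\<dots> \<le> P (g - k * g) * P f + P k * P f" by (intro add_mono P_mult)
    also have "\<dots> \<le> 2 * e * P f + P k * P f"
      using P0 order_trans[OF P_le fg(3)] by (intro add_right_mono mult_right_mono) auto
    finally have "1 * P f \<le> (2 * e + P k) * P f" by (simp add: algebra_simps)
    moreover have "P f > 0" using P0 fg(1) by (metis less_eq_real_def)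
    ultimately show ?thesis by simp
  qed
  have "1 \<le> P k + d" if "0 < d" for d
    using near_1[of "min (1/4) (d / 2)"] that min.cobounded1[of "1/4" "d / 2"] min.cobounded2[of "1/4" "d / 2"] by force
  then have "1 \<le> P k" by (rule field_le_epsilon)
  then have "cmod w * norm h \<le> cmod w * P h" using w(1) by (simp add: k_def P_scale)
  then show ?thesis using \<open>w \<noteq> 0\<close> by simp
qed

subsection \<open>Uniqueness of the C*-norm\<close>

lemma cmod_le_norm_spectrum:
  assumes "z \<in> spectrum UNIV (a :: 'a::cstar_algebra)"
  shows "cmod z \<le> norm a"
proof (cases "z = 0")
  case False
  then have "\<not> quasi_invertible UNIV (inverse z *\<^sub>C a)"
    using assms spectrum_iff_quasi_invertible[OF star_subalgebra_UNIV] by blast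
  then have "1 \<le> norm (inverse z *\<^sub>C a)"
    using quasi_invertible_norm_less_1 by (meson not_le)
  then show ?thesis using False
    by (simp add: norm_scaleC norm_inverse pos_le_divide_eq flip: divide_inverse_commute)
qed simp

lemma (in normed_star_subalgebra) p_le_norm:
  assumes rad: "\<And>b. b \<in> B \<Longrightarrow>
      spectral_radius B (star b * b) = spectral_radius UNIV (star b * b)"
    and b: "b \<in> B"
  shows "p b \<le> norm b"
proof -
  define h where "h = star b * b"
  have h: "h \<in> B" "star h = h" using b by (simp_all add: h_def star_mult star_star)
  have "spectral_radius B h \<le> ereal (norm h)"
    unfolding h_def rad[OF b] unfolding spectral_radius_def
    by (intro SUP_least) (simp add: cmod_le_norm_spectrum)
  then have rB: "cmod z \<le> norm h" if "z \<in> spectrum B h" for z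
    using that by (simp add: spectral_radius_def SUP_le_iff)
  have "p h \<le> norm h"
  proof (cases "h = 0")
    case True
    then show ?thesis using p_eq_0_iff[of h] by simp
  next
    case False
    then obtain w where w: "cmod w * p h \<le> 1" "\<not> quasi_invertible B (w *\<^sub>C h)"
      using not_quasi_invertible_self_adjoint[OF h] by blast
    have "w \<noteq> 0" using w(2) quasi_inverse_zero by (auto simp: quasi_invertible_def)
    \<comment> \<open>This spectral value has modulus at least p h, and equality of the spectral
      radii bounds it by norm h.\<close>
    then have "inverse w \<in> spectrum B h"
      using w(2) spectrum_iff_quasi_invertible[OF subalgebra h(1), of "inverse w"] by simp
    then have "inverse (cmod w) \<le> norm h" using rB by (simp flip: norm_inverse)
    moreover have "p h \<le> inverse (cmod w)"
      using w(1) \<open>w \<noteq> 0\<close> by (simp add: inverse_eq_divide pos_le_divide_eq mult.commute)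
    ultimately show ?thesis by linarith
  qed
  then have "(p b)\<^sup>2 \<le> (norm b)\<^sup>2"
    by (simp add: h_def p_star_mult b norm_star_mult_self)
  then show ?thesis by (rule power2_le_imp_le) simp
qed

section \<open>Extension by continuity\<close>

lemma dense_induct:
  assumes "closure B = UNIV" "closed {x. Q x}" "\<And>x. x \<in> B \<Longrightarrow> Q x"
  shows "Q x"
  using closure_minimal[of B "{x. Q x}"] assms by auto

text \<open>Domination by the norm makes \<open>p\<close> 1-Lipschitz on the dense \<open>B\<close>.
  The seminorm properties are closed conditions and pass to limits; definiteness is recovered later
  from the ideals.\<close>

lemma (in normed_star_subalgebra) continuous_extension:
  assumes dense: "closure B = UNIV" and le: "\<And>b. b \<in> B \<Longrightarrow> p b \<le> norm b"
  obtains P where "\<And>b. b \<in> B \<Longrightarrow> P b = p b" "continuous_on UNIV P"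
    "\<And>x. 0 \<le> P x" "\<And>x. P x \<le> norm x" "\<And>x y. P (x + y) \<le> P x + P y"
    "\<And>x y. P (x * y) \<le> P x * P y" "\<And>c x. P (c *\<^sub>C x) = cmod c * P x"
proof -
  have lip: "dist (p a) (p b) \<le> 1 * dist a b" if "a \<in> B" "b \<in> B" for a b
    using p_triangle[of "a - b" b] p_triangle[of "b - a" a] le[of "a - b"] le[of "b - a"] that
    by (simp add: dist_norm norm_minus_commute abs_le_iff)
  then have "1-lipschitz_on B p" by (intro lipschitz_onI) auto
  then have "uniformly_continuous_on B p" by (rule lipschitz_on_uniformly_continuous)
  then obtain P where P: "uniformly_continuous_on (closure B) P" "\<And>x. x \<in> B \<Longrightarrow> p x = P x"
    by (rule uniformly_continuous_on_extension_on_closure) blast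
  then have cont: "continuous_on UNIV P"
    using dense uniformly_continuous_imp_continuous by metis
  have comp: "continuous_on UNIV (\<lambda>x. P (u x))" if "continuous_on UNIV u" for u :: "'a \<Rightarrow> 'a"
    using continuous_on_compose2[OF cont that] by simp
  have "continuous_on UNIV (\<lambda>x. c *\<^sub>C x :: 'a)" for c
  proof -
    have "(cmod c)-lipschitz_on UNIV (\<lambda>x. c *\<^sub>C x :: 'a)"
      by (intro lipschitz_onI) (simp_all add: dist_norm norm_scaleC flip: scaleC.scale_right_diff_distrib)
    then show ?thesis by (rule lipschitz_on_continuous_on)
  qed
  note conts = continuous_intros cont comp this
  show ?thesis
  proof
    show "\<And>b. b \<in> B \<Longrightarrow> P b = p b" "continuous_on UNIV P" using P(2) cont by auto
    show "0 \<le> P x" for x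
      by (rule dense_induct[OF dense]) (auto intro!: closed_Collect_le conts simp flip: P(2))
    show "P x \<le> norm x" for x
      by (rule dense_induct[OF dense]) (auto intro!: closed_Collect_le conts le simp flip: P(2))
    show "P (c *\<^sub>C x) = cmod c * P x" for c x
      by (rule dense_induct[OF dense, where x = x])
        (auto intro!: closed_Collect_eq conts simp: p_scaleC simp flip: P(2))
    \<comment> \<open>The arguments are released from \<open>B\<close> one at a time: first x with y
      still in \<open>B\<close>, then y.\<close>
    have *: "P (x + y) \<le> P x + P y" if "y \<in> B" for x y
    proof (rule dense_induct[OF dense, where x = x and Q = "\<lambda>x. P (x + y) \<le> P x + P y"])
      show "closed {x. P (x + y) \<le> P x + P y}" by (intro closed_Collect_le conts)
      show "P (x + y) \<le> P x + P y" if "x \<in> B" for x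
        using p_triangle[OF that \<open>y \<in> B\<close>] that \<open>y \<in> B\<close> by (simp flip: P(2))
    qed
    show "P (x + y) \<le> P x + P y" for x y
    proof (rule dense_induct[OF dense, where x = y and Q = "\<lambda>y. P (x + y) \<le> P x + P y"])
      show "closed {y. P (x + y) \<le> P x + P y}" by (intro closed_Collect_le conts)
    qed (rule *)
    have *: "P (x * y) \<le> P x * P y" if "y \<in> B" for x y
    proof (rule dense_induct[OF dense, where x = x and Q = "\<lambda>x. P (x * y) \<le> P x * P y"])
      show "closed {x. P (x * y) \<le> P x * P y}" by (intro closed_Collect_le conts)
      show "P (x * y) \<le> P x * P y" if "x \<in> B" for x
        using p_mult[OF that \<open>y \<in> B\<close>] that \<open>y \<in> B\<close> by (simp flip: P(2))
    qed
    show "P (x * y) \<le> P x * P y" for x y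
    proof (rule dense_induct[OF dense, where x = y and Q = "\<lambda>y. P (x * y) \<le> P x * P y"])
      show "closed {y. P (x * y) \<le> P x * P y}" by (intro closed_Collect_le conts)
    qed (rule *)
  qed
qed

theorem theorem2p3:
  fixes B :: "'a::cstar_algebra set" and p :: "'a \<Rightarrow> real"
  assumes "star_subalgebra B"
    and "closure B = UNIV"
    and "\<And>b. b \<in> B \<Longrightarrow>
           spectral_radius B (star b * b) = spectral_radius UNIV (star b * b)"
    and "\<And>I. two_sided_ideal I \<Longrightarrow> closed I \<Longrightarrow>
           star_subalgebra (I \<inter> B) \<and> I \<subseteq> closure (I \<inter> B)"
  shows "cstar_norm_on B p \<longleftrightarrow> (\<forall>b\<in>B. p b = norm b)"
proof
  assume "cstar_norm_on B p"
  then interpret normed_star_subalgebra B p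
    using assms(1) by unfold_locales
  have le: "p b \<le> norm b" if "b \<in> B" for b
    using p_le_norm[OF assms(3) that] .
  obtain P where P: "\<And>b. b \<in> B \<Longrightarrow> P b = p b" "continuous_on UNIV P"
    "\<And>x. 0 \<le> P x" "\<And>x. P x \<le> norm x" "\<And>x y. P (x + y) \<le> P x + P y"
    "\<And>x y. P (x * y) \<le> P x * P y" "\<And>c x. P (c *\<^sub>C x) = cmod c * P x"
    using continuous_extension[OF assms(2) le] by metis
  define I where "I = {x. P x = 0}"
  have "two_sided_ideal I"
    unfolding two_sided_ideal_def complex_subspace_def
  proof (intro conjI ballI allI)
    show "0 \<in> I" using P(7)[of 0 0] by (simp add: I_def)
    show "x + y \<in> I" if "x \<in> I" "y \<in> I" for x y
      using that P(5)[of x y] P(3)[of "x + y"] by (simp add: I_def)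
    show "c *\<^sub>C x \<in> I" if "x \<in> I" for c x using that by (simp add: I_def P(7))
    show "a * x \<in> I" "x * a \<in> I" if "x \<in> I" for x a
      using that P(6)[of a x] P(3)[of "a * x"] P(6)[of x a] P(3)[of "x * a"] by (simp_all add: I_def)
  qed
  moreover have "closed I"
    unfolding I_def by (intro closed_Collect_eq P(2) continuous_intros)
  ultimately have "I \<subseteq> closure (I \<inter> B)" using assms(4) by blast
  moreover have "I \<inter> B \<subseteq> {0}" by (auto simp: I_def P(1) p_eq_0_iff)
  then have "closure (I \<inter> B) \<subseteq> {0}" by (simp add: closure_minimal)
  ultimately have P0: "x = 0" if "P x = 0" for x using that by (auto simp: I_def)
  show "\<forall>b\<in>B. p b = norm b"
  proof
    fix b assume b: "b \<in> B"
    \<comment> \<open>\<open>norm_minimal\<close> covers self-adjoint elements; the C*-identities of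
      \<open>norm\<close> and \<open>p\<close> carry the bound over to b.\<close>
    have "norm (star b * b) \<le> P (star b * b)"
      using P P0 by (intro norm_minimal) (auto simp: star_mult star_star)
    then have "(norm b)\<^sup>2 \<le> (p b)\<^sup>2"
      using b by (simp add: P(1) p_star_mult norm_star_mult_self)
    then have "norm b \<le> p b" by (rule power2_le_imp_le) (simp add: b)
    with le[OF b] show "p b = norm b" by simp
  qed
qed (simp add: cstar_norm_on_norm assms(1))

end
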